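(* Let $G=(V,E,\mu,w)$ be a weighted forest with $n$ vertices. Then for every admissible index $\mathrm{ind}$ and every $k\in\{1,\dots,n\}$, $$h_k(G)=\lambda_k^{\mathrm{ind}}(\Delta_1)=\underline{\lambda_k^{\mathrm{ind}}}(\Delta_1).$$
   Context: A weighted graph is a quadruple $G=(V,E,\mu,w)$ with finite vertex set $V=\{1,\dots,n\}$, edge set $E\subseteq\{\{u,v\}:u\neq v\text{ in }V\}$, vertex weight $\mu:V\to(0,\infty)$ and edge weight $w:E\to(0,\infty)$; write $\mu_v=\mu(v)$, $w_{uv}=w(\{u,v\})$. A weighted forest is a weighted graph whose underlying graph has no cycles (it need not be connected). For nonempty $A\subseteq V$, $\partial A=\{\{u,v\}\in E:u\in A,\ v\notin A\}$ and $\phi(A)=\dfrac{\sum_{\{u,v\}\in\partial A}w_{uv}}{\sum_{v\in A}\mu_v}$. The Cheeger $k$-constant is $h_k(G)=\min\max_{1\le i\le k}\phi(A_i)$, the minimum being over all $k$-tuples $(A_1,\dots,A_k)$ of pairwise disjoint nonempty subsets of $V$. Admissible index: let $\mathcal S$ be the class of all nonempty compact sets $S\subset\mathbb R^m\setminus\{0\}$ ($m\ge1$ arbitrary) with $S=-S$ (origin-symmetric). A function $\mathrm{ind}:\mathcal S\to\mathbb Z_{\ge0}$ is admissible if (1) $\mathrm{ind}(\mathbb S^{k-1})=k$ for $k=1,2,\dots$, where $\mathbb S^{k-1}$ is the unit sphere of $\mathbb R^k$; (2) $S\subseteq S'$ implies $\mathrm{ind}(S)\le\mathrm{ind}(S')$;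 (3) every $S\in\mathcal S$ has a closed neighborhood $U\in\mathcal S$ with $\mathrm{ind}(U)=\mathrm{ind}(S)$; (4) $\mathrm{ind}(S)\le\mathrm{ind}(\eta(S))$ for every odd continuous map $\eta$ on $S$ with $\eta(S)\in\mathcal S$. For $x\in\mathbb R^n\setminus\{0\}$ let $\Phi_1(x)=\dfrac{\sum_{\{u,v\}\in E}w_{uv}|x_u-x_v|}{\sum_{v\in V}\mu_v|x_v|}$. Define $$\lambda_k^{\mathrm{ind}}(\Delta_1)=\inf_{\substack{S\in\mathcal S,\ S\subset\mathbb R^n\\ \mathrm{ind}(S)\ge k}}\ \max_{x\in S}\Phi_1(x),\qquad \underline{\lambda_k^{\mathrm{ind}}}(\Delta_1)=\sup_{\substack{S\in\mathcal S,\ S\subset\mathbb R^n\\ \mathrm{ind}(S)\ge n-k+1}}\ \min_{x\in S}\Phi_1(x).$$ *)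

theory Defs
  imports "HOL-Analysis.Analysis" "HOL-Analysis.Abstract_Euclidean_Space"
begin

record wgraph =
  verts :: "nat set"
  edges :: "nat set set"
  vweight :: "nat \<Rightarrow> real"
  eweight :: "nat set \<Rightarrow> real"

(* The vertices are numbered 0, ..., n-1 (instead of 1, ..., n), so that they are exactly the
   coordinate indices of Euclidean_space n.  The values of vweight outside verts and of eweight
   outside edges are irrelevant. *)
definition weighted_graph :: "nat \<Rightarrow> wgraph \<Rightarrow> bool" where
  "weighted_graph n G \<longleftrightarrow>
     verts G = {..<n} \<and>
     edges G \<subseteq> {{u, v} | u v. u \<in> verts G \<and> v \<in> verts G \<and> u \<noteq> v} \<and>
     (\<forall>v\<in>verts G. 0 < vweight G v) \<and>
     (\<forall>e\<in>edges G. 0 < eweight G e)"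

definition is_cycle :: "wgraph \<Rightarrow> nat list \<Rightarrow> bool" where
  "is_cycle G vs \<longleftrightarrow>
     3 \<le> length vs \<and> distinct vs \<and>
     (\<forall>i<length vs. {vs ! i, vs ! (Suc i mod length vs)} \<in> edges G)"

definition weighted_forest :: "nat \<Rightarrow> wgraph \<Rightarrow> bool" where
  "weighted_forest n G \<longleftrightarrow> weighted_graph n G \<and> (\<nexists>vs. is_cycle G vs)"

definition edge_boundary :: "wgraph \<Rightarrow> nat set \<Rightarrow> nat set set" where
  "edge_boundary G A = {{u, v} | u v. {u, v} \<in> edges G \<and> u \<in> A \<and> v \<notin> A}"

definition expansion :: "wgraph \<Rightarrow> nat set \<Rightarrow> real" where
  "expansion G A = (\<Sum>e\<in>edge_boundary G A. eweight G e) / (\<Sum>v\<in>A. vweight G v)"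

definition disjoint_tuples :: "wgraph \<Rightarrow> nat \<Rightarrow> (nat \<Rightarrow> nat set) set" where
  "disjoint_tuples G k =
     {A \<in> {1..k} \<rightarrow>\<^sub>E Pow (verts G). (\<forall>i\<in>{1..k}. A i \<noteq> {}) \<and> disjoint_family_on A {1..k}}"

definition cheeger_const :: "wgraph \<Rightarrow> nat \<Rightarrow> real" where
  "cheeger_const G k = (MIN A\<in>disjoint_tuples G k. MAX i\<in>{1..k}. expansion G (A i))"

(* Real m-space is the space of all functions x with x i = 0 for i >= m. *)
definition sym_compacts :: "nat \<Rightarrow> (nat \<Rightarrow> real) set set" where
  "sym_compacts m =
     {S. 1 \<le> m \<and> S \<noteq> {} \<and> compactin (Euclidean_space m) S \<and> (\<lambda>i. 0) \<notin> S \<and>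
         S = (\<lambda>x i. - x i) ` S}"

(* An index also receives the dimension m of the ambient space of its argument, because
   Euclidean_space m is literally contained in Euclidean_space (Suc m), while the real spaces
   of different dimensions are distinct.  Only the values of "ind m" on sym_compacts m matter.
   nsphere k is the k-dimensional unit sphere in real (k+1)-space. *)
definition admissible_index :: "(nat \<Rightarrow> (nat \<Rightarrow> real) set \<Rightarrow> nat) \<Rightarrow> bool" where
  "admissible_index ind \<longleftrightarrow>
     (\<forall>k\<ge>1. ind k (topspace (nsphere (k - 1))) = k) \<and>
     (\<forall>m. \<forall>S\<in>sym_compacts m. \<forall>S'\<in>sym_compacts m. S \<subseteq> S' \<longrightarrow> ind m S \<le> ind m S') \<and>
     (\<forall>m. \<forall>S\<in>sym_compacts m. \<exists>U\<in>sym_compacts m.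
        closedin (Euclidean_space m) U \<and> S \<subseteq> Euclidean_space m interior_of U \<and>
        ind m U = ind m S) \<and>
     (\<forall>m m'. \<forall>S\<in>sym_compacts m. \<forall>\<eta>.
        continuous_map (subtopology (Euclidean_space m) S) (Euclidean_space m') \<eta> \<and>
        (\<forall>x\<in>S. \<eta> (\<lambda>i. - x i) = (\<lambda>i. - \<eta> x i)) \<and>
        \<eta> ` S \<in> sym_compacts m' \<longrightarrow>
        ind m S \<le> ind m' (\<eta> ` S))"

(* Each edge {u,v} is counted once, through its ordered representation with u < v. *)
definition Phi1 :: "wgraph \<Rightarrow> (nat \<Rightarrow> real) \<Rightarrow> real" where
  "Phi1 G x =
     (\<Sum>(u, v)\<in>{(u, v). u < v \<and> {u, v} \<in> edges G}. eweight G {u, v} * \<bar>x u - x v\<bar>) /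
     (\<Sum>v\<in>verts G. vweight G v * \<bar>x v\<bar>)"

(* Phi1 G is continuous away from the origin, so the inner SUP and INF below, taken over nonempty
   compact sets avoiding the origin, are a maximum and a minimum. *)
definition lambda_ind :: "(nat \<Rightarrow> (nat \<Rightarrow> real) set \<Rightarrow> nat) \<Rightarrow> wgraph \<Rightarrow> nat \<Rightarrow> real" where
  "lambda_ind ind G k =
     (let n = card (verts G) in
      INF S\<in>{S \<in> sym_compacts n. k \<le> ind n S}. SUP x\<in>S. Phi1 G x)"

definition lower_lambda_ind :: "(nat \<Rightarrow> (nat \<Rightarrow> real) set \<Rightarrow> nat) \<Rightarrow> wgraph \<Rightarrow> nat \<Rightarrow> real" where
  "lower_lambda_ind ind G k =
     (let n = card (verts G) in
      SUP S\<in>{S \<in> sym_compacts n. n - k + 1 \<le> ind n S}. INF x\<in>S. Phi1 G x)"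

end

theory Submission
  imports Defs
begin

text \<open>
Write \<open>h\<close> for the Cheeger \<open>k\<close>-constant. The theorem holds because on a forest there are two
linear subspaces of complementary strength: a space \<open>X\<close> of dimension \<open>k\<close> on which
\<open>\<Phi>\<^sub>1 \<le> h\<close>, and a space \<open>Y\<close> of codimension less than \<open>k\<close> on which \<open>\<Phi>\<^sub>1 \<ge> h\<close>. The axioms of an
admissible index say just enough about linear subspaces: the unit sphere of a space of
dimension \<open>d\<close> has index at least \<open>d\<close> (\<open>sphere_of_block_functions\<close>), and a set of index
greater than \<open>d\<close> meets every space of codimension \<open>d\<close>, since otherwise the \<open>d\<close> defining
functionals would map it oddly into the unit sphere of \<open>d\<close>-space
(\<open>odd_functionals_common_zero\<close>). Hence the sphere of \<open>X\<close> bounds the min-max value from above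
and the sphere of \<open>Y\<close> bounds the max-min value from below, while each competitor in the
min-max problem meets \<open>Y\<close> and each competitor in the max-min problem meets \<open>X\<close>. All four
inequalities together give the equalities.

The space \<open>X\<close> is spanned by the indicators of an optimal \<open>k\<close>-tuple of disjoint sets; the
triangle inequality bounds \<open>\<Phi>\<^sub>1\<close> on it (\<open>total_variation_block_le\<close>). This works in every graph.

The space \<open>Y\<close> consists of the functions vanishing on a suitable set \<open>R\<close> of fewer than \<open>k\<close>
vertices, and here the forest enters. By definition of \<open>h\<close> there are no \<open>k\<close> disjoint sets of
expansion less than \<open>h\<close>. In a forest the connected vertex sets have the Konig property: the
members of any family can be hit by as many vertices as the family has pairwise disjoint members
(\<open>forest_packing_hitting\<close>). So fewer than \<open>k\<close> vertices \<open>R\<close> hit all connected sets of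
expansion less than \<open>h\<close>. Every set of expansion less than \<open>h\<close> contains a connected one, so
all sets that avoid \<open>R\<close> have expansion at least \<open>h\<close>. A discrete coarea argument
(\<open>total_variation_ge\<close>) carries this over from sets to functions vanishing on \<open>R\<close>.
\<close>

section \<open>Symmetric compact sets and admissible indices\<close>

lemma compactin_Euclidean_space_iff:
  "compactin (Euclidean_space m) S \<longleftrightarrow> compact S \<and> (\<forall>x\<in>S. \<forall>i\<ge>m. x i = 0)"
  unfolding Euclidean_space_def compactin_subtopology
  by (auto simp: euclidean_product_topology)

lemma sym_compacts_iff:
  "S \<in> sym_compacts m \<longleftrightarrow>
     1 \<le> m \<and> S \<noteq> {} \<and> compact S \<and> (\<forall>x\<in>S. \<forall>i\<ge>m. x i = 0) \<and> (\<lambda>i. 0) \<notin> S \<and>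
     (\<forall>x\<in>S. (\<lambda>i. - x i) \<in> S)"
proof -
  have "S = (\<lambda>x i. - x i) ` S \<longleftrightarrow> (\<forall>x\<in>S. (\<lambda>i. - x i) \<in> S)"
  proof
    assume R: "\<forall>x\<in>S. (\<lambda>i. - x i) \<in> S"
    have "x \<in> (\<lambda>x i. - x i) ` S" if "x \<in> S" for x
      using R that by (intro image_eqI[where x = "\<lambda>i. - x i"]) auto
    then show "S = (\<lambda>x i. - x i) ` S" using R by blast
  qed blast
  then show ?thesis
    unfolding sym_compacts_def mem_Collect_eq compactin_Euclidean_space_iff by blast
qed

text \<open>
The unit sphere of real \<open>j\<close>-space, indexed by the dimension of the ambient space and not by
the dimension of the sphere, so that its index is its parameter.
\<close>

definition unit_sphere :: "nat \<Rightarrow> (nat \<Rightarrow> real) set" where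
  "unit_sphere j = {x. (\<Sum>i<j. (x i)\<^sup>2) = 1 \<and> (\<forall>i\<ge>j. x i = 0)}"

lemma topspace_nsphere_eq_unit_sphere:
  assumes "1 \<le> j"
  shows "topspace (nsphere (j - 1)) = unit_sphere j"
proof -
  obtain i where "j = Suc i" using assms by (cases j) auto
  then show ?thesis
    by (auto simp: nsphere unit_sphere_def lessThan_Suc_atMost Suc_le_eq)
qed

lemma zero_notin_unit_sphere: "(\<lambda>i. 0) \<notin> unit_sphere j"
  by (simp add: unit_sphere_def)

lemma compact_unit_sphere: "compact (unit_sphere j)"
proof -
  let ?C = "PiE UNIV (\<lambda>i::nat. {-1..1::real})"
  have "compactin (powertop_real UNIV) ?C"
    by (subst compactin_PiE) auto
  then have "compact ?C"
    by (simp add: euclidean_product_topology)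
  \<comment> \<open>The sphere is a closed subset of the cube, which is compact by Tychonoff's theorem.\<close>
  moreover have "closed (unit_sphere j)"
    unfolding unit_sphere_def Collect_conj_eq Collect_all_eq Collect_imp_eq
    by (intro closed_Int closed_INT closed_Un closed_Collect_eq ballI closed_Collect_const
          continuous_intros continuous_on_product_coordinates) auto
  moreover have "unit_sphere j \<subseteq> ?C"
  proof
    fix x assume x: "x \<in> unit_sphere j"
    have "\<bar>x i\<bar> \<le> 1" for i
    proof (cases "i < j")
      case True
      then have "(x i)\<^sup>2 \<le> (\<Sum>i<j. (x i)\<^sup>2)"
        by (intro member_le_sum) auto
      then show ?thesis using x by (simp add: unit_sphere_def abs_square_le_1)
    qed (use x in \<open>simp add: unit_sphere_def\<close>)
    then show "x \<in> ?C" by (auto simp: abs_le_iff minus_le_iff)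
  qed
  ultimately show ?thesis
    by (metis compact_Int_closed inf.absorb2)
qed

lemma unit_sphere_in_sym_compacts:
  assumes "1 \<le> j"
  shows "unit_sphere j \<in> sym_compacts j"
proof -
  have "(\<lambda>i. if i = 0 then 1 else 0) \<in> unit_sphere j"
    using in_topspace_nsphere[of "j - 1"] assms by (simp add: topspace_nsphere_eq_unit_sphere[symmetric])
  then show ?thesis
    using assms compact_unit_sphere[of j] zero_notin_unit_sphere[of j]
    by (auto simp: sym_compacts_iff unit_sphere_def)
qed

lemma index_unit_sphere:
  assumes "admissible_index ind" "1 \<le> j"
  shows "ind j (unit_sphere j) = j"
  using assms topspace_nsphere_eq_unit_sphere unfolding admissible_index_def by metis

text \<open>
The monotonicity of the index under odd maps, with continuity expressed coordinatewise in the
product topology of \<^typ>\<open>nat \<Rightarrow> real\<close>. Both lemmas below on linear subspaces rest on it.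
\<close>

lemma odd_continuous_image:
  assumes ind: "admissible_index ind" and S: "S \<in> sym_compacts m" and m': "1 \<le> m'"
    and cont: "\<And>i. continuous_on S (\<lambda>x. f x i)"
    and odd: "\<And>x i. x \<in> S \<Longrightarrow> f (\<lambda>i. - x i) i = - f x i"
    and supp: "\<And>x i. x \<in> S \<Longrightarrow> m' \<le> i \<Longrightarrow> f x i = 0"
    and nz: "\<And>x. x \<in> S \<Longrightarrow> f x \<noteq> (\<lambda>i. 0)"
  shows "f ` S \<in> sym_compacts m' \<and> ind m S \<le> ind m' (f ` S)"
proof
  have c: "continuous_on S f"
    using cont by (rule continuous_on_coordinatewise_then_product)
  have neg: "(\<lambda>i. - f x i) = f (\<lambda>i. - x i)" if "x \<in> S" for x
    using odd[OF that] by auto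
  show *: "f ` S \<in> sym_compacts m'"
    using S supp nz m' compact_continuous_image[OF c] neg unfolding sym_compacts_iff
    by (auto simp: image_iff fun_eq_iff)
  have "continuous_map (subtopology (Euclidean_space m) S) (Euclidean_space m') f"
    unfolding cm_Euclidean_space_iff_continuous_on
    using c supp by (auto simp: topspace_Euclidean_space intro: continuous_on_subset)
  moreover have "\<forall>x\<in>S. f (\<lambda>i. - x i) = (\<lambda>i. - f x i)"
    using neg by metis
  ultimately show "ind m S \<le> ind m' (f ` S)"
    using ind S * unfolding admissible_index_def by blast
qed

text \<open>
A Borsuk-Ulam principle for \<open>d = card I\<close> odd functionals. Without a common zero, the vector of
their values can be normalized, which is an odd map into the unit sphere of \<open>d\<close>-space; by the axioms the index
would then be at most \<open>d\<close>.
\<close>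

lemma odd_functionals_common_zero:
  assumes ind: "admissible_index ind" and S: "S \<in> sym_compacts n"
    and I: "finite I" and small: "card I < ind n S"
    and cont: "\<And>i. i \<in> I \<Longrightarrow> continuous_on S (L i)"
    and odd: "\<And>i x. i \<in> I \<Longrightarrow> x \<in> S \<Longrightarrow> L i (\<lambda>i. - x i) = - L i x"
  shows "\<exists>x\<in>S. \<forall>i\<in>I. L i x = (0::real)"
proof (rule ccontr)
  assume none: "\<not> (\<exists>x\<in>S. \<forall>i\<in>I. L i x = 0)"
  define j where "j = card I"
  have "S \<noteq> {}" using S by (simp add: sym_compacts_iff)
  then have "I \<noteq> {}" using none by auto
  then have j: "1 \<le> j" using I by (simp add: j_def Suc_le_eq card_gt_0_iff)
  obtain g where g: "bij_betw g {..<j} I"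
    using ex_bij_betw_nat_finite[OF I] by (auto simp: j_def atLeast0LessThan)
  define N where "N x = sqrt (\<Sum>i<j. (L (g i) x)\<^sup>2)" for x
  define f where "f x i = (if i < j then L (g i) x / N x else 0)" for x i
  have gI: "g i \<in> I" if "i < j" for i using g that by (auto simp: bij_betw_def)
  have Npos: "N x > 0" if x: "x \<in> S" for x
  proof -
    obtain i where "i \<in> I" "L i x \<noteq> 0" using none x by blast
    then obtain i' where "i' < j" "L (g i') x \<noteq> 0"
      using g by (auto simp: bij_betw_def)
    then have "0 < (\<Sum>i<j. (L (g i) x)\<^sup>2)"
      by (intro sum_pos2[of _ i']) auto
    then show ?thesis by (simp add: N_def)
  qed
  have Nodd: "N (\<lambda>i. - x i) = N x" if "x \<in> S" for x
    using odd[OF gI that] by (simp add: N_def)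
  have on: "f x \<in> unit_sphere j" if x: "x \<in> S" for x
  proof -
    have "(\<Sum>i<j. (f x i)\<^sup>2) = (\<Sum>i<j. (L (g i) x)\<^sup>2) / (N x)\<^sup>2"
      by (simp add: f_def power_divide sum_divide_distrib)
    also have "\<dots> = 1"
      using Npos[OF x] by (simp add: N_def sum_nonneg)
    finally show ?thesis by (simp add: unit_sphere_def f_def)
  qed
  have contN: "continuous_on S N"
    unfolding N_def using cont[OF gI] by (intro continuous_intros) auto
  have contf: "continuous_on S (\<lambda>x. f x i)" for i
  proof (cases "i < j")
    case True
    then show ?thesis
      unfolding f_def using Npos contN cont[OF gI[OF True]]
      by (auto intro!: continuous_intros simp: less_le)
  qed (simp add: f_def)
  have "f ` S \<in> sym_compacts j \<and> ind n S \<le> ind j (f ` S)"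
  proof (rule odd_continuous_image[OF ind S j contf])
    show "f (\<lambda>i. - x i) i = - f x i" if "x \<in> S" for x i
      using odd[OF gI that] Nodd[OF that] by (simp add: f_def)
    show "f x i = 0" if "j \<le> i" for x i using that by (simp add: f_def)
    show "f x \<noteq> (\<lambda>i. 0)" if "x \<in> S" for x
      using on[OF that] zero_notin_unit_sphere[of j] by metis
  qed
  then have im: "f ` S \<in> sym_compacts j" "ind n S \<le> ind j (f ` S)" by auto
  have "f ` S \<subseteq> unit_sphere j" using on by blast
  then have "ind j (f ` S) \<le> ind j (unit_sphere j)"
    using ind im(1) unit_sphere_in_sym_compacts[OF j] unfolding admissible_index_def by blast
  then show False
    using im(2) small index_unit_sphere[OF ind j] by (simp add: j_def)
qed

text \<open>
A block function is constant on each fibre of a labelling \<open>c\<close> of \<open>U\<close> and zero outside \<open>U\<close>. The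
block functions form a space whose dimension is the number of labels, and the set \<open>S\<close> is the
image of a unit sphere under the linear parametrization by the values on the labels. Two cases matter:
\<open>c\<close> labels the members of a disjoint family, or \<open>c\<close> is the identity and the block functions are
all functions supported on \<open>U\<close>.
\<close>

lemma sphere_of_block_functions:
  fixes c :: "nat \<Rightarrow> 'a"
  assumes ind: "admissible_index ind" and U: "U \<subseteq> {..<n}" "U \<noteq> {}"
  shows "\<exists>S\<in>sym_compacts n. card (c ` U) \<le> ind n S \<and>
           (\<forall>x\<in>S. \<exists>t. x = (\<lambda>v. if v \<in> U then t (c v) else 0))"
proof -
  define j where "j = card (c ` U)"
  have fin: "finite (c ` U)" using U finite_subset by blast
  then have j: "1 \<le> j" using U by (simp add: j_def Suc_le_eq card_gt_0_iff)
  have n: "1 \<le> n" using U by (cases n) auto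
  obtain g where g: "bij_betw g (c ` U) {..<j}"
    using ex_bij_betw_finite_nat[OF fin] by (auto simp: j_def atLeast0LessThan)
  define f where "f t v = (if v \<in> U then t (g (c v)) else 0)" for t :: "nat \<Rightarrow> real" and v
  have nz: "f t \<noteq> (\<lambda>i. 0)" if t: "t \<in> unit_sphere j" for t
  proof
    assume 0: "f t = (\<lambda>i. 0)"
    have "t i = 0" if "i < j" for i
    proof -
      have "i \<in> g ` c ` U"
        using g \<open>i < j\<close> by (simp add: bij_betw_def)
      then obtain v where "v \<in> U" "i = g (c v)" by blast
      then show ?thesis using fun_cong[OF 0, of v] by (simp add: f_def)
    qed
    then show False using t by (simp add: unit_sphere_def)
  qed
  have contf: "continuous_on (unit_sphere j) (\<lambda>t. f t v)" for v
    by (cases "v \<in> U")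
      (auto simp: f_def intro: continuous_on_subset[OF continuous_on_product_coordinates])
  have im: "f ` unit_sphere j \<in> sym_compacts n \<and>
      ind j (unit_sphere j) \<le> ind n (f ` unit_sphere j)"
  proof (rule odd_continuous_image[OF ind unit_sphere_in_sym_compacts[OF j] n contf])
    show "f t v = 0" if "n \<le> v" for t v using that U by (auto simp: f_def)
    show "f t \<noteq> (\<lambda>i. 0)" if "t \<in> unit_sphere j" for t by (rule nz[OF that])
  qed (auto simp: f_def)
  have "\<exists>t'. x = (\<lambda>v. if v \<in> U then t' (c v) else 0)" if "x \<in> f ` unit_sphere j" for x
  proof -
    from that obtain t where "x = f t" by (elim imageE)
    then show ?thesis by (intro exI[of _ "t \<circ> g"]) (auto simp: f_def)
  qed
  then show ?thesis
    using im index_unit_sphere[OF ind j] by (auto simp: j_def)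
qed

section \<open>Total variation and mass\<close>

text \<open>
Numerator and denominator of \<open>\<Phi>\<^sub>1\<close> are treated separately, because the bounds \<open>\<Phi>\<^sub>1 \<le> h\<close> and
\<open>\<Phi>\<^sub>1 \<ge> h\<close> are proved in the additive form that compares the total variation with \<open>h\<close> times
the mass.
\<close>

definition total_variation :: "wgraph \<Rightarrow> (nat \<Rightarrow> real) \<Rightarrow> real" where
  "total_variation G x =
     (\<Sum>(u, v)\<in>{(u, v). u < v \<and> {u, v} \<in> edges G}. eweight G {u, v} * \<bar>x u - x v\<bar>)"

definition mass :: "wgraph \<Rightarrow> (nat \<Rightarrow> real) \<Rightarrow> real" where
  "mass G x = (\<Sum>v\<in>verts G. vweight G v * \<bar>x v\<bar>)"

lemma Phi1_eq: "Phi1 G x = total_variation G x / mass G x"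
  by (simp add: Phi1_def total_variation_def mass_def)

lemma edge_verts:
  assumes "weighted_graph n G" "{u, v} \<in> edges G"
  shows "u \<in> verts G" "v \<in> verts G" "u \<noteq> v"
proof -
  obtain a b where "{u, v} = {a, b}" "a \<in> verts G" "b \<in> verts G" "a \<noteq> b"
    using assms unfolding weighted_graph_def by blast
  then show "u \<in> verts G" "v \<in> verts G" "u \<noteq> v" by (auto simp: doubleton_eq_iff)
qed

lemma finite_verts: "weighted_graph n G \<Longrightarrow> finite (verts G)"
  by (simp add: weighted_graph_def)

lemma eweight_nonneg: "weighted_graph n G \<Longrightarrow> e \<in> edges G \<Longrightarrow> 0 \<le> eweight G e"
  by (simp add: weighted_graph_def less_imp_le)

lemma vweight_nonneg: "weighted_graph n G \<Longrightarrow> v \<in> verts G \<Longrightarrow> 0 \<le> vweight G v"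
  by (simp add: weighted_graph_def less_imp_le)

lemma finite_ordered_edges:
  assumes "weighted_graph n G"
  shows "finite {(u, v). u < v \<and> {u, v} \<in> edges G}"
proof -
  have "{(u, v). u < v \<and> {u, v} \<in> edges G} \<subseteq> verts G \<times> verts G"
    using edge_verts[OF assms] by auto
  then show ?thesis using finite_verts[OF assms] finite_subset by blast
qed

lemma total_variation_nonneg: "weighted_graph n G \<Longrightarrow> 0 \<le> total_variation G x"
  unfolding total_variation_def by (intro sum_nonneg) (auto intro!: mult_nonneg_nonneg eweight_nonneg)

lemma mass_nonneg: "weighted_graph n G \<Longrightarrow> 0 \<le> mass G x"
  unfolding mass_def by (intro sum_nonneg mult_nonneg_nonneg) (auto intro: vweight_nonneg)

lemma mass_pos:
  assumes G: "weighted_graph n G" and v: "v \<in> verts G" "x v \<noteq> 0"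
  shows "0 < mass G x"
  unfolding mass_def
proof (rule sum_pos2)
  show "0 < vweight G v * \<bar>x v\<bar>"
    using G v by (simp add: weighted_graph_def)
qed (use G v in \<open>auto intro!: mult_nonneg_nonneg vweight_nonneg finite_verts\<close>)

lemma mass_pos_sym_compacts:
  assumes G: "weighted_graph n G" and S: "S \<in> sym_compacts n" and x: "x \<in> S"
  shows "0 < mass G x"
proof -
  have "x \<noteq> (\<lambda>i. 0)" using S x by (auto simp: sym_compacts_iff)
  then obtain v where v: "x v \<noteq> 0" by auto
  then have "v < n" using S x unfolding sym_compacts_iff by (meson not_le)
  then have "v \<in> verts G" using G by (simp add: weighted_graph_def)
  then show ?thesis using mass_pos[OF G] v by blast
qed

lemma mass_indicator_pos:
  assumes "weighted_graph n G" "A \<subseteq> verts G" "A \<noteq> {}"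
  shows "0 < mass G (indicator A)"
proof -
  obtain v where "v \<in> A" using assms by blast
  then show ?thesis using assms by (intro mass_pos[of n G v]) (auto simp: indicator_def)
qed

text \<open>
This identity turns every statement about expansions into one about functions: cut weight and
vertex weight of a set are total variation and mass of its indicator.
\<close>

lemma expansion_eq_Phi1:
  assumes G: "weighted_graph n G" and A: "A \<subseteq> verts G"
  shows "expansion G A = Phi1 G (indicator A)"
proof -
  let ?O = "{(u, v). u < v \<and> {u, v} \<in> edges G}"
  let ?B = "{p \<in> ?O. (fst p \<in> A) \<noteq> (snd p \<in> A)}"
  let ?e = "\<lambda>p. {fst p, snd p} :: nat set"
  have inj: "inj_on ?e ?B"
    by (auto simp: inj_on_def doubleton_eq_iff)
  have img: "?e ` ?B = edge_boundary G A"
  proof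
    show "?e ` ?B \<subseteq> edge_boundary G A"
      unfolding edge_boundary_def by (auto simp: insert_commute) blast+
    show "edge_boundary G A \<subseteq> ?e ` ?B"
    proof
      fix e assume "e \<in> edge_boundary G A"
      then obtain u v where uv: "e = {u, v}" "{u, v} \<in> edges G" "u \<in> A" "v \<notin> A"
        by (auto simp: edge_boundary_def)
      then have "u \<noteq> v" by auto
      then consider "u < v" | "v < u" by linarith
      then show "e \<in> ?e ` ?B"
      proof cases
        case 1
        then show ?thesis using uv by (intro image_eqI[of _ _ "(u, v)"]) auto
      next
        case 2
        then show ?thesis using uv by (intro image_eqI[of _ _ "(v, u)"]) (auto simp: insert_commute)
      qed
    qed
  qed
  have "total_variation G (indicator A) = (\<Sum>p\<in>?O. if (fst p \<in> A) \<noteq> (snd p \<in> A) then eweight G (?e p) else 0)"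
    unfolding total_variation_def by (intro sum.cong) (auto simp: indicator_def)
  also have "\<dots> = (\<Sum>p\<in>?B. eweight G (?e p))"
    by (rule sum.inter_filter[symmetric, OF finite_ordered_edges[OF G]])
  also have "\<dots> = (\<Sum>e\<in>edge_boundary G A. eweight G e)"
    \<comment> \<open>Each cut edge has exactly one representation with increasing endpoints.\<close>
    unfolding img[symmetric] sum.reindex[OF inj] by (simp add: o_def)
  finally have 1: "total_variation G (indicator A) = (\<Sum>e\<in>edge_boundary G A. eweight G e)" .
  have "mass G (indicator A) = (\<Sum>v\<in>verts G. if v \<in> A then vweight G v else 0)"
    unfolding mass_def by (intro sum.cong) (auto simp: indicator_def)
  also have "\<dots> = (\<Sum>v\<in>A. vweight G v)"
    using A by (simp add: sum.inter_restrict[OF finite_verts[OF G], symmetric] Int_absorb1)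
  finally show ?thesis using 1 by (simp add: expansion_def Phi1_eq)
qed

lemma expansion_le_iff:
  assumes "weighted_graph n G" "A \<subseteq> verts G" "A \<noteq> {}"
  shows "expansion G A \<le> h \<longleftrightarrow> total_variation G (indicator A) \<le> h * mass G (indicator A)"
  using mass_indicator_pos[OF assms] expansion_eq_Phi1[OF assms(1,2)]
  by (simp add: Phi1_eq pos_divide_le_eq)

lemma le_expansion_iff:
  assumes "weighted_graph n G" "A \<subseteq> verts G" "A \<noteq> {}"
  shows "h \<le> expansion G A \<longleftrightarrow> h * mass G (indicator A) \<le> total_variation G (indicator A)"
  using mass_indicator_pos[OF assms] expansion_eq_Phi1[OF assms(1,2)]
  by (simp add: Phi1_eq pos_le_divide_eq)

text \<open>
Suprema and infima of reals are meaningful only for bounded sets; a bound on the whole space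
serves all compact sets at once.
\<close>

lemma Phi1_bounded:
  assumes G: "weighted_graph n G"
  shows "\<exists>C. \<forall>x. 0 \<le> Phi1 G x \<and> Phi1 G x \<le> C"
proof -
  let ?O = "{(u, v). u < v \<and> {u, v} \<in> edges G}"
  define C where "C = (\<Sum>(u, v)\<in>?O. eweight G {u, v} * (1 / vweight G u + 1 / vweight G v))"
  have "total_variation G x \<le> C * mass G x" for x
  proof -
    have pt: "\<bar>x v\<bar> \<le> 1 / vweight G v * mass G x" if v: "v \<in> verts G" for v
    proof -
      have "vweight G v * \<bar>x v\<bar> \<le> mass G x"
        unfolding mass_def using v G
        by (intro member_le_sum) (auto intro!: mult_nonneg_nonneg vweight_nonneg finite_verts)
      moreover have "0 < vweight G v" using G v by (simp add: weighted_graph_def)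
      ultimately show ?thesis by (simp add: field_simps)
    qed
    show ?thesis
      unfolding total_variation_def C_def sum_distrib_right
    proof (rule sum_mono, clarify)
      fix u v assume e: "{u, v} \<in> edges G"
      have "\<bar>x u - x v\<bar> \<le> (1 / vweight G u + 1 / vweight G v) * mass G x"
        using pt[OF edge_verts(1)[OF G e]] pt[OF edge_verts(2)[OF G e]] by (simp add: distrib_right)
      then show "eweight G {u, v} * \<bar>x u - x v\<bar>
          \<le> eweight G {u, v} * (1 / vweight G u + 1 / vweight G v) * mass G x"
        using eweight_nonneg[OF G e] by (metis mult.assoc mult_left_mono)
    qed
  qed
  moreover have "0 \<le> C"
    unfolding C_def
  proof (intro sum_nonneg, clarify)
    fix u v assume e: "{u, v} \<in> edges G"
    show "0 \<le> eweight G {u, v} * (1 / vweight G u + 1 / vweight G v)"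
      using eweight_nonneg[OF G e] vweight_nonneg[OF G edge_verts(1)[OF G e]]
        vweight_nonneg[OF G edge_verts(2)[OF G e]] by simp
  qed
  ultimately have "Phi1 G x \<le> C" for x
    using mass_nonneg[OF G, of x] by (cases "mass G x = 0") (auto simp: Phi1_eq pos_divide_le_eq)
  then show ?thesis
    using mass_nonneg[OF G] total_variation_nonneg[OF G] by (auto simp: Phi1_eq)
qed

text \<open>
Total variation is a seminorm, and mass is additive over functions with disjoint supports. A
bound on the expansion of each block therefore passes to all linear combinations of the
indicators of the blocks.
\<close>

lemma total_variation_block_le:
  assumes G: "weighted_graph n G" and U: "U \<subseteq> verts G"
    and x: "x = (\<lambda>v. if v \<in> U then t (c v) else 0)"
    and fib: "\<And>i. i \<in> c ` U \<Longrightarrow> total_variation G (indicator {v \<in> U. c v = i})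
                \<le> h * mass G (indicator {v \<in> U. c v = i})"
  shows "total_variation G x \<le> h * mass G x"
proof -
  let ?O = "{(u, v). u < v \<and> {u, v} \<in> edges G}"
  define a where "a i = (indicator {v \<in> U. c v = i} :: nat \<Rightarrow> real)" for i
  have fin: "finite (c ` U)" using U finite_verts[OF G] finite_subset by blast
  have decomp: "f (c v) = (\<Sum>i\<in>c ` U. f i * a i v)" if "v \<in> U" for f v
  proof -
    have "(\<Sum>i\<in>c ` U. f i * a i v) = (\<Sum>i\<in>c ` U. if i = c v then f i else 0)"
      using that by (intro sum.cong) (auto simp: a_def)
    then show ?thesis using that fin by simp
  qed
  have decomp0: "(\<Sum>i\<in>c ` U. f i * a i v) = 0" if "v \<notin> U" for f v
    using that by (intro sum.neutral) (auto simp: a_def)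
  have xs: "x v = (\<Sum>i\<in>c ` U. t i * a i v)" for v
    using decomp[of v t] decomp0[of v t] by (auto simp: x)
  have axs: "\<bar>x v\<bar> = (\<Sum>i\<in>c ` U. \<bar>t i\<bar> * a i v)" for v
    using decomp[of v "\<lambda>i. \<bar>t i\<bar>"] decomp0[of v "\<lambda>i. \<bar>t i\<bar>"] by (auto simp: x)
  have "total_variation G x
      \<le> (\<Sum>(u, v)\<in>?O. \<Sum>i\<in>c ` U. \<bar>t i\<bar> * (eweight G {u, v} * \<bar>a i u - a i v\<bar>))"
    unfolding total_variation_def
  proof (rule sum_mono, clarify)
    fix u v assume e: "{u, v} \<in> edges G"
    have "x u - x v = (\<Sum>i\<in>c ` U. t i * (a i u - a i v))"
      by (simp add: xs right_diff_distrib sum_subtractf)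
    then have "\<bar>x u - x v\<bar> \<le> (\<Sum>i\<in>c ` U. \<bar>t i\<bar> * \<bar>a i u - a i v\<bar>)"
      by (metis (no_types, lifting) abs_mult sum.cong sum_abs)
    then have "eweight G {u, v} * \<bar>x u - x v\<bar>
        \<le> eweight G {u, v} * (\<Sum>i\<in>c ` U. \<bar>t i\<bar> * \<bar>a i u - a i v\<bar>)"
      using eweight_nonneg[OF G e] by (rule mult_left_mono)
    then show "eweight G {u, v} * \<bar>x u - x v\<bar>
        \<le> (\<Sum>i\<in>c ` U. \<bar>t i\<bar> * (eweight G {u, v} * \<bar>a i u - a i v\<bar>))"
      by (simp add: sum_distrib_left mult.left_commute)
  qed
  also have "\<dots> = (\<Sum>i\<in>c ` U. \<bar>t i\<bar> * total_variation G (a i))"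
    unfolding total_variation_def sum_distrib_left case_prod_unfold by (rule sum.swap)
  also have "\<dots> \<le> (\<Sum>i\<in>c ` U. \<bar>t i\<bar> * (h * mass G (a i)))"
    using fib by (intro sum_mono mult_left_mono) (auto simp: a_def)
  also have "\<dots> = h * (\<Sum>i\<in>c ` U. \<Sum>v\<in>verts G. vweight G v * (\<bar>t i\<bar> * a i v))"
    unfolding mass_def sum_distrib_left by (intro sum.cong) (auto simp: a_def)
  also have "\<dots> = h * mass G x"
    unfolding mass_def axs sum_distrib_left by (subst sum.swap) simp
  finally show ?thesis .
qed

text \<open>
The discrete coarea argument. If \<open>m\<close> is the least positive value of \<open>x\<close> and \<open>A\<close> its support, then
subtracting \<open>m\<close> times the indicator of \<open>A\<close> reduces total variation and mass by exactly \<open>m\<close> times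
those of the indicator, and it shrinks the support. So \<open>x\<close> is a nonnegative combination of
indicators of nested sets along which both functionals are additive.
\<close>

lemma total_variation_ge_nonneg:
  assumes G: "weighted_graph n G"
    and level: "\<And>A. A \<subseteq> W \<Longrightarrow> A \<subseteq> verts G \<Longrightarrow> A \<noteq> {} \<Longrightarrow>
                  h * mass G (indicator A) \<le> total_variation G (indicator A)"
    and "\<And>v. v \<in> verts G \<Longrightarrow> 0 \<le> x v" "\<And>v. v \<in> verts G \<Longrightarrow> v \<notin> W \<Longrightarrow> x v = 0"
  shows "h * mass G x \<le> total_variation G x"
  using assms(3,4)
proof (induction "card {v \<in> verts G. x v \<noteq> 0}" arbitrary: x rule: less_induct)
  case (less x)
  let ?O = "{(u, v). u < v \<and> {u, v} \<in> edges G}"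
  define A where "A = {v \<in> verts G. x v \<noteq> 0}"
  have finA: "finite A" using finite_verts[OF G] by (simp add: A_def)
  show ?case
  proof (cases "A = {}")
    case True
    then have "mass G x = 0" by (auto simp: mass_def A_def intro!: sum.neutral)
    then show ?thesis using total_variation_nonneg[OF G] by simp
  next
    case False
    define m where "m = Min (x ` A)"
    define y where "y v = x v - m * indicator A v" for v
    have "m \<in> x ` A" unfolding m_def using finA False by (intro Min_in) auto
    then obtain w where w: "w \<in> A" "m = x w" by (elim imageE)
    have m_le: "m \<le> x v" if "v \<in> A" for v using finA that by (simp add: m_def)
    have m0: "0 \<le> m" using w less.prems(1) by (auto simp: A_def)
    have out: "x v = 0" if "v \<in> verts G" "v \<notin> A" for v using that by (auto simp: A_def)
    have "{v \<in> verts G. y v \<noteq> 0} \<subset> A"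
      using w out by (auto simp: y_def A_def indicator_def)
    then have "card {v \<in> verts G. y v \<noteq> 0} < card {v \<in> verts G. x v \<noteq> 0}"
      using finA psubset_card_mono unfolding A_def by blast
    moreover have "0 \<le> y v" if "v \<in> verts G" for v
      using that m_le less.prems(1) by (cases "v \<in> A") (auto simp: y_def)
    moreover have "y v = 0" if "v \<in> verts G" "v \<notin> W" for v
      using that less.prems(2) by (auto simp: y_def A_def)
    ultimately have IH: "h * mass G y \<le> total_variation G y"
      using less.hyps by blast
    have tv: "total_variation G x = total_variation G y + m * total_variation G (indicator A)"
      unfolding total_variation_def sum_distrib_left sum.distrib[symmetric]
    proof (intro sum.cong refl, clarify)
      fix u v assume e: "{u, v} \<in> edges G"
      have uv: "u \<in> verts G" "v \<in> verts G" using edge_verts[OF G e] by auto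
      have "\<bar>x u - x v\<bar> = \<bar>y u - y v\<bar> + m * \<bar>indicator A u - indicator A v\<bar>"
        using out[OF uv(1)] out[OF uv(2)] m_le[of u] m_le[of v] m0
        by (cases "u \<in> A"; cases "v \<in> A") (auto simp: y_def)
      then show "eweight G {u, v} * \<bar>x u - x v\<bar> = eweight G {u, v} * \<bar>y u - y v\<bar> +
          m * (eweight G {u, v} * \<bar>indicator A u - indicator A v\<bar>)"
        by (simp add: algebra_simps)
    qed
    have ms: "mass G x = mass G y + m * mass G (indicator A)"
      unfolding mass_def sum_distrib_left sum.distrib[symmetric]
    proof (intro sum.cong refl)
      fix v assume v: "v \<in> verts G"
      have "\<bar>x v\<bar> = \<bar>y v\<bar> + m * \<bar>indicator A v\<bar>"
        using out[OF v] m_le[of v] m0 by (cases "v \<in> A") (auto simp: y_def)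
      then show "vweight G v * \<bar>x v\<bar> = vweight G v * \<bar>y v\<bar> + m * (vweight G v * \<bar>indicator A v\<bar>)"
        by (simp add: algebra_simps)
    qed
    have "A \<subseteq> W" using less.prems(2) by (auto simp: A_def)
    then have "h * mass G (indicator A) \<le> total_variation G (indicator A)"
      using level False by (auto simp: A_def)
    then have "m * (h * mass G (indicator A)) \<le> m * total_variation G (indicator A)"
      using m0 by (rule mult_left_mono)
    then show ?thesis using IH unfolding tv ms by (simp add: algebra_simps)
  qed
qed

text \<open>
Taking absolute values keeps the mass and the support and does not increase the total
variation, so the sign condition can be dropped.
\<close>

lemma total_variation_ge:
  assumes G: "weighted_graph n G"
    and level: "\<And>A. A \<subseteq> W \<Longrightarrow> A \<subseteq> verts G \<Longrightarrow> A \<noteq> {} \<Longrightarrow>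
                  h * mass G (indicator A) \<le> total_variation G (indicator A)"
    and supp: "\<And>v. v \<in> verts G \<Longrightarrow> v \<notin> W \<Longrightarrow> x v = 0"
  shows "h * mass G x \<le> total_variation G x"
proof -
  have "h * mass G (\<lambda>v. \<bar>x v\<bar>) \<le> total_variation G (\<lambda>v. \<bar>x v\<bar>)"
    by (rule total_variation_ge_nonneg[OF G level]) (auto simp: supp)
  also have "\<dots> \<le> total_variation G x"
    unfolding total_variation_def
    by (intro sum_mono) (auto intro!: mult_left_mono eweight_nonneg[OF G])
  finally show ?thesis by (simp add: mass_def)
qed

section \<open>Packing and hitting connected vertex sets of a forest\<close>

text \<open>
All neighbours of the first vertex of a longest path lie on the path. If there were two, one of
them would be at position at least two and would close a cycle with the initial segment.
\<close>

lemma exists_leaf: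
  assumes acyclic: "\<nexists>vs. is_cycle G vs" and loopless: "\<And>v. {v} \<notin> edges G"
    and W: "finite W" "W \<noteq> {}"
  shows "\<exists>v\<in>W. \<forall>a\<in>W. \<forall>b\<in>W. {v, a} \<in> edges G \<longrightarrow> {v, b} \<in> edges G \<longrightarrow> a = b"
proof (rule ccontr)
  assume no_leaf: "\<not> ?thesis"
  define is_path where "is_path vs \<longleftrightarrow> vs \<noteq> [] \<and> distinct vs \<and> set vs \<subseteq> W \<and>
      (\<forall>i. Suc i < length vs \<longrightarrow> {vs ! i, vs ! Suc i} \<in> edges G)" for vs
  obtain w where "w \<in> W" using W by blast
  then have "is_path [w]" by (simp add: is_path_def)
  moreover have "length vs < Suc (card W)" if "is_path vs" for vs
    using that W card_mono[of W "set vs"] by (simp add: is_path_def distinct_card less_Suc_eq_le)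
  ultimately obtain vs where vs: "is_path vs" and longest: "\<And>us. is_path us \<Longrightarrow> length us \<le> length vs"
    using ex_has_greatest_nat[of is_path "[w]" length "Suc (card W)"] by auto
  have vs_props: "vs \<noteq> []" "distinct vs" "set vs \<subseteq> W"
      "\<And>i. Suc i < length vs \<Longrightarrow> {vs ! i, vs ! Suc i} \<in> edges G"
    using vs by (auto simp: is_path_def)
  have on_path: "a \<in> set vs" if a: "a \<in> W" "{hd vs, a} \<in> edges G" for a
  proof (rule ccontr)
    assume "a \<notin> set vs"
    then have "is_path (a # vs)"
      using vs_props a
      by (auto simp: is_path_def nth_Cons hd_conv_nth insert_commute split: nat.split)
    then show False using longest by fastforce
  qed
  have "hd vs \<in> W" using vs_props by auto
  then obtain a b where ab: "a \<in> W" "b \<in> W" "{hd vs, a} \<in> edges G" "{hd vs, b} \<in> edges G" "a \<noteq> b"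
    using no_leaf by blast
  obtain i where i: "i < length vs" "a = vs ! i" using on_path ab by (metis in_set_conv_nth)
  obtain j where j: "j < length vs" "b = vs ! j" using on_path ab by (metis in_set_conv_nth)
  have "i \<noteq> 0" "j \<noteq> 0" using ab i j loopless vs_props(1) by (auto simp: hd_conv_nth intro: ccontr)
  moreover have "i \<noteq> j" using ab i j by auto
  ultimately have "2 \<le> i \<or> 2 \<le> j" by linarith
  then obtain l where l: "2 \<le> l" "l < length vs" "{hd vs, vs ! l} \<in> edges G"
    using ab i j by blast
  have "is_cycle G (take (Suc l) vs)"
    unfolding is_cycle_def
  proof (intro conjI allI impI)
    fix i assume "i < length (take (Suc l) vs)"
    then consider "i < l" | "i = l" using l by fastforce
    then show "{take (Suc l) vs ! i, take (Suc l) vs ! (Suc i mod length (take (Suc l) vs))} \<in> edges G"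
    proof cases
      case 1
      then show ?thesis using l vs_props(4)[of i] by (simp add: min_def)
    next
      case 2
      have "{vs ! l, vs ! 0} \<in> edges G"
        using l(3) vs_props(1) by (simp add: hd_conv_nth insert_commute)
      then show ?thesis using l 2 vs_props(1) by (simp add: min_absorb2)
    qed
  qed (use l vs_props in auto)
  then show False using acyclic by blast
qed

text \<open>
Connectivity is expressed by cuts and not by paths: this is the form that minimal sets of small
expansion satisfy directly, and it is easily preserved when a leaf is removed.
\<close>

definition induces_connected :: "wgraph \<Rightarrow> nat set \<Rightarrow> bool" where
  "induces_connected G A \<longleftrightarrow> A \<noteq> {} \<and>
     (\<forall>B. B \<noteq> {} \<longrightarrow> B \<subset> A \<longrightarrow> (\<exists>b\<in>B. \<exists>c\<in>A - B. {b, c} \<in> edges G))"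

lemma induces_connected_neighbour:
  assumes "induces_connected G A" "v \<in> A" "A \<noteq> {v}"
  shows "\<exists>u\<in>A - {v}. {v, u} \<in> edges G"
proof -
  have "{v} \<subset> A" using assms by blast
  then show ?thesis using assms(1) unfolding induces_connected_def by blast
qed

lemma induces_connected_remove_leaf:
  assumes conn: "induces_connected G A" and nonsingle: "A \<noteq> {v}"
    and leaf: "\<And>a b. a \<in> A \<Longrightarrow> b \<in> A \<Longrightarrow> {v, a} \<in> edges G \<Longrightarrow> {v, b} \<in> edges G \<Longrightarrow> a = b"
  shows "induces_connected G (A - {v})"
proof (cases "v \<in> A")
  case True
  obtain u where u: "u \<in> A - {v}" "{v, u} \<in> edges G"
    using induces_connected_neighbour[OF conn True nonsingle] by blast
  show ?thesis
    unfolding induces_connected_def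
  proof (intro conjI allI impI)
    fix B assume B: "B \<noteq> {}" "B \<subset> A - {v}"
    \<comment> \<open>Keep the leaf on the side of its only neighbour, so that it is not incident with the
      edge that crosses the cut.\<close>
    define B' where "B' = (if u \<in> B then insert v B else B)"
    have "B' \<noteq> {}" "B' \<subset> A" using B True by (auto simp: B'_def)
    then obtain b c where bc: "b \<in> B'" "c \<in> A - B'" "{b, c} \<in> edges G"
      using conn unfolding induces_connected_def by blast
    have "b \<noteq> v"
    proof
      assume "b = v"
      then have "u \<in> B" using bc B by (auto simp: B'_def split: if_splits)
      moreover have "c = u" using leaf[of c u] bc u \<open>b = v\<close> by auto
      ultimately show False using bc by (auto simp: B'_def)
    qed
    moreover have "c \<noteq> v"
    proof
      assume "c = v"
      then have "u \<notin> B" using bc by (auto simp: B'_def)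
      moreover have "b = u"
        using leaf[of b u] bc u \<open>c = v\<close> \<open>B' \<subset> A\<close> by (auto simp: insert_commute)
      ultimately show False using bc by (auto simp: B'_def)
    qed
    ultimately show "\<exists>b\<in>B. \<exists>c\<in>A - {v} - B. {b, c} \<in> edges G"
      using bc by (auto simp: B'_def split: if_splits)
  qed (use u in auto)
qed (use conn in simp)

text \<open>
The Konig property of connected sets in a forest, by induction on the vertices, removing a leaf
\<open>v\<close>. If the singleton of \<open>v\<close> belongs to the family, then \<open>v\<close> is put into the hitting set and its
singleton into the packing, and only the members without \<open>v\<close> remain. Otherwise \<open>v\<close> is deleted
from all members. A packing of the reduced members lifts to a packing of the original ones: two
members that contain \<open>v\<close> also share its only neighbour, so they were not disjoint after the
deletion.
\<close>

lemma forest_packing_hitting: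
  assumes acyclic: "\<nexists>vs. is_cycle G vs" and loopless: "\<And>v. {v} \<notin> edges G"
    and "finite W" "\<And>A. A \<in> F \<Longrightarrow> A \<subseteq> W \<and> induces_connected G A"
  shows "\<exists>R D. R \<subseteq> W \<and> D \<subseteq> F \<and> pairwise disjnt D \<and> finite D \<and> card R \<le> card D \<and>
           (\<forall>A\<in>F. A \<inter> R \<noteq> {})"
  using assms(3,4)
proof (induction "card W" arbitrary: W F)
  case 0
  then have "F = {}" by (force simp: induces_connected_def)
  then show ?case by (intro exI[of _ "{}"]) auto
next
  case (Suc s)
  then have "W \<noteq> {}" by auto
  obtain v where v: "v \<in> W"
    and leaf: "\<And>a b. a \<in> W \<Longrightarrow> b \<in> W \<Longrightarrow> {v, a} \<in> edges G \<Longrightarrow> {v, b} \<in> edges G \<Longrightarrow> a = b"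
    using exists_leaf[OF acyclic loopless \<open>finite W\<close> \<open>W \<noteq> {}\<close>] by blast
  have s: "s = card (W - {v})" "finite (W - {v})" using Suc.hyps(2) Suc.prems(1) v by auto
  show ?case
  proof (cases "{v} \<in> F")
    case True
    define F' where "F' = {A \<in> F. v \<notin> A}"
    have conn: "A \<subseteq> W - {v} \<and> induces_connected G A" if "A \<in> F'" for A
      using that Suc.prems(2) by (auto simp: F'_def)
    obtain R D where RD: "R \<subseteq> W - {v}" "D \<subseteq> F'" "pairwise disjnt D" "finite D"
        "card R \<le> card D" "\<forall>A\<in>F'. A \<inter> R \<noteq> {}"
      using Suc.hyps(1)[OF s conn] by metis
    have vD: "v \<notin> A" if "A \<in> D" for A using that RD(2) by (auto simp: F'_def)
    then have "{v} \<notin> D" by blast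
    then have "card (insert v R) \<le> card (insert {v} D)"
      using RD(4,5) card_insert_if[OF finite_subset[OF RD(1) s(2)], of v] by (simp split: if_splits)
    moreover have "pairwise disjnt (insert {v} D)"
      using RD(3) vD by (auto simp: pairwise_insert disjnt_def)
    moreover have "\<forall>A\<in>F. A \<inter> insert v R \<noteq> {}"
      using RD(6) by (auto simp: F'_def)
    ultimately show ?thesis
      using RD(1,2,4) v True
      by (intro exI[of _ "insert v R"] exI[of _ "insert {v} D"]) (auto simp: F'_def)
  next
    case False
    define F' where "F' = (\<lambda>A. A - {v}) ` F"
    have conn: "A \<subseteq> W - {v} \<and> induces_connected G A" if "A \<in> F'" for A
    proof -
      obtain B where B: "B \<in> F" "A = B - {v}" using \<open>A \<in> F'\<close> unfolding F'_def by blast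
      have BW: "B \<subseteq> W" "induces_connected G B" using Suc.prems(2) B(1) by auto
      have "B \<noteq> {v}" using False B(1) by auto
      then have "induces_connected G (B - {v})"
        using induces_connected_remove_leaf[OF BW(2)] leaf BW(1) by blast
      then show ?thesis using B BW by auto
    qed
    obtain R D where RD: "R \<subseteq> W - {v}" "D \<subseteq> F'" "pairwise disjnt D" "finite D"
        "card R \<le> card D" "\<forall>A\<in>F'. A \<inter> R \<noteq> {}"
      using Suc.hyps(1)[OF s conn] by metis
    have "\<forall>A\<in>D. \<exists>B\<in>F. A = B - {v}" using RD(2) by (auto simp: F'_def)
    then obtain g where g: "\<And>A. A \<in> D \<Longrightarrow> g A \<in> F \<and> A = g A - {v}" by metis
    have inj: "inj_on g D" using g by (metis inj_onI)
    have nb: "\<exists>u\<in>A. {v, u} \<in> edges G \<and> u \<in> W" if AD: "A \<in> D" "v \<in> g A" for A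
    proof -
      have gA: "g A \<in> F" "A = g A - {v}" using g[OF AD(1)] by auto
      then have "g A \<noteq> {v}" using False by auto
      then obtain u where "u \<in> g A - {v}" "{v, u} \<in> edges G"
        using induces_connected_neighbour[OF _ AD(2)] Suc.prems(2)[OF gA(1)] by blast
      then show ?thesis
        using gA(2) Suc.prems(2)[OF gA(1)] by blast
    qed
    have disj: "disjnt (g A) (g B)" if AB: "A \<in> D" "B \<in> D" "A \<noteq> B" for A B
    proof -
      have AB0: "A \<inter> B = {}" using pairwiseD[OF RD(3) AB] by (simp add: disjnt_def)
      have "\<not> (v \<in> g A \<and> v \<in> g B)"
        using nb[OF AB(1)] nb[OF AB(2)] leaf AB0 by blast
      then show ?thesis using AB0 g[OF AB(1)] g[OF AB(2)] unfolding disjnt_def by blast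
    qed
    have "pairwise disjnt (g ` D)"
      using disj unfolding pairwise_def by blast
    moreover have "\<forall>A\<in>F. A \<inter> R \<noteq> {}" using RD(6) by (auto simp: F'_def)
    ultimately show ?thesis
      using RD(1,4,5) g by (intro exI[of _ R] exI[of _ "g ` D"]) (auto simp: card_image[OF inj])
  qed
qed

text \<open>
A minimal subset of small expansion is connected: were it split into two parts without edges
between them, cut weight and vertex weight would both add up, so one of the parts
would have small expansion as well.
\<close>

lemma connected_subset_small_expansion:
  assumes G: "weighted_graph n G" and A: "A \<subseteq> verts G" "A \<noteq> {}" and small: "expansion G A < h"
  shows "\<exists>B\<subseteq>A. induces_connected G B \<and> expansion G B < h"
proof -
  define P where "P B \<longleftrightarrow> B \<subseteq> A \<and> B \<noteq> {} \<and> expansion G B < h" for B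
  have "P A" using A small by (simp add: P_def)
  moreover have finP: "finite B" if "P B" for B
    using that A finite_verts[OF G] unfolding P_def by (meson finite_subset)
  ultimately obtain B where B: "P B" and minimal: "\<And>C. P C \<Longrightarrow> card B \<le> card C"
    using ex_has_least_nat[of P A card] by blast
  have big: "h * mass G (indicator C) \<le> total_variation G (indicator C)" if "C \<noteq> {}" "C \<subset> B" for C
  proof -
    have "card C < card B" using that(2) finP[OF B] by (rule psubset_card_mono[rotated])
    then have "\<not> P C" using minimal by fastforce
    then have "h \<le> expansion G C" using that B by (auto simp: P_def)
    then show ?thesis using le_expansion_iff[OF G, of C] that B A by (auto simp: P_def)
  qed
  have "induces_connected G B"
    unfolding induces_connected_def
  proof (intro conjI allI impI)
    show "B \<noteq> {}" using B by (simp add: P_def)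
    fix C assume C: "C \<noteq> {}" "C \<subset> B"
    show "\<exists>b\<in>C. \<exists>c\<in>B - C. {b, c} \<in> edges G"
    proof (rule ccontr)
      assume none: "\<not> ?thesis"
      have ind: "indicator B v = indicator C v + (indicator (B - C) v :: real)" for v
        using C by (auto simp: indicator_def)
      have "total_variation G (indicator B) = total_variation G (indicator C) + total_variation G (indicator (B - C))"
        unfolding total_variation_def sum.distrib[symmetric]
      proof (intro sum.cong refl, clarify)
        fix u v assume e: "{u, v} \<in> edges G"
        have "\<not> (u \<in> C \<and> v \<in> B - C)" using none e by blast
        moreover have "\<not> (v \<in> C \<and> u \<in> B - C)"
          using none e unfolding insert_commute[of u v] by blast
        ultimately have "\<bar>indicator B u - indicator B v :: real\<bar> =
            \<bar>indicator C u - indicator C v\<bar> + \<bar>indicator (B - C) u - indicator (B - C) v\<bar>"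
          using C by (auto simp: indicator_def)
        then show "eweight G {u, v} * \<bar>indicator B u - indicator B v\<bar> =
            eweight G {u, v} * \<bar>indicator C u - indicator C v\<bar> +
            eweight G {u, v} * \<bar>indicator (B - C) u - indicator (B - C) v\<bar>"
          by (simp add: distrib_left)
      qed
      moreover have "mass G (indicator B) = mass G (indicator C) + mass G (indicator (B - C))"
        unfolding mass_def sum.distrib[symmetric]
        by (intro sum.cong) (auto simp: ind distrib_left)
      moreover have "B - C \<noteq> {}" "B - C \<subset> B" using C by auto
      ultimately have "h * mass G (indicator B) \<le> total_variation G (indicator B)"
        using big[OF C] big[of "B - C"] by (simp add: distrib_left)
      then show False
        using le_expansion_iff[OF G, of B h] B A by (auto simp: P_def)
    qed
  qed
  then show ?thesis using B by (auto simp: P_def)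
qed

section \<open>The Cheeger constant\<close>

lemma cheeger_const_attained:
  assumes G: "weighted_graph n G" and k: "k \<in> {1..n}"
  shows "\<exists>A\<in>disjoint_tuples G k. \<forall>i\<in>{1..k}. expansion G (A i) \<le> cheeger_const G k"
    and "A \<in> disjoint_tuples G k \<Longrightarrow> \<exists>i\<in>{1..k}. cheeger_const G k \<le> expansion G (A i)"
proof -
  let ?M = "\<lambda>A. MAX i\<in>{1..k}. expansion G (A i)"
  have "disjoint_tuples G k \<subseteq> {1..k} \<rightarrow>\<^sub>E Pow (verts G)"
    by (auto simp: disjoint_tuples_def)
  then have fin: "finite (disjoint_tuples G k)"
    using finite_verts[OF G] by (meson finite_PiE finite_Pow_iff finite_atLeastAtMost finite_subset)
  have "restrict (\<lambda>i. {i - 1}) {1..k} \<in> disjoint_tuples G k"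
    using G k by (auto simp: disjoint_tuples_def disjoint_family_on_def weighted_graph_def)
  then have ne: "disjoint_tuples G k \<noteq> {}" by blast
  obtain A where A: "A \<in> disjoint_tuples G k" "cheeger_const G k = ?M A"
    using Min_in[of "?M ` disjoint_tuples G k"] fin ne unfolding cheeger_const_def by blast
  then show "\<exists>A\<in>disjoint_tuples G k. \<forall>i\<in>{1..k}. expansion G (A i) \<le> cheeger_const G k"
    by (intro bexI[of _ A]) auto
  show "\<exists>i\<in>{1..k}. cheeger_const G k \<le> expansion G (A i)" if "A \<in> disjoint_tuples G k" for A
  proof -
    have "cheeger_const G k \<le> ?M A"
      unfolding cheeger_const_def using fin that by simp
    moreover have "?M A \<in> (\<lambda>i. expansion G (A i)) ` {1..k}"
      using k by (intro Max_in) auto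
    ultimately show ?thesis by auto
  qed
qed

text \<open>
An optimal tuple, recast as a labelling \<open>c\<close> of its union; its block functions form the
\<open>k\<close>-dimensional space on which \<open>\<Phi>\<^sub>1\<close> is at most the Cheeger constant.
\<close>

lemma optimal_blocks:
  assumes G: "weighted_graph n G" and k: "k \<in> {1..n}"
  shows "\<exists>U c. U \<subseteq> verts G \<and> c ` U = {1..k} \<and>
     (\<forall>t. total_variation G (\<lambda>v. if v \<in> U then t (c v) else 0)
        \<le> cheeger_const G k * mass G (\<lambda>v. if v \<in> U then t (c v) else 0))"
proof -
  obtain A where A: "A \<in> disjoint_tuples G k"
    and small: "\<And>i. i \<in> {1..k} \<Longrightarrow> expansion G (A i) \<le> cheeger_const G k"
    using cheeger_const_attained(1)[OF G k] by blast
  have Ai: "A i \<subseteq> verts G" "A i \<noteq> {}" if "i \<in> {1..k}" for i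
    using A that by (auto simp: disjoint_tuples_def)
  have dis: "i = j" if "i \<in> {1..k}" "j \<in> {1..k}" "v \<in> A i" "v \<in> A j" for i j v
    using A that unfolding disjoint_tuples_def disjoint_family_on_def by blast
  define U where "U = (\<Union>i\<in>{1..k}. A i)"
  define c where "c v = (THE i. i \<in> {1..k} \<and> v \<in> A i)" for v
  have c: "c v = i" if "i \<in> {1..k}" "v \<in> A i" for v i
    unfolding c_def using that dis by (intro the_equality) auto
  have fib: "{v \<in> U. c v = i} = A i" if "i \<in> {1..k}" for i
    using that c by (auto simp: U_def)
  have cU: "c ` U = {1..k}"
  proof
    show "c ` U \<subseteq> {1..k}" using c by (auto simp: U_def)
    show "{1..k} \<subseteq> c ` U"
    proof
      fix i assume i: "i \<in> {1..k}"
      then obtain v where "v \<in> A i" using Ai(2) by blast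
      then have "v \<in> U \<and> c v = i" using fib[OF i] by blast
      then show "i \<in> c ` U" by blast
    qed
  qed
  have UV: "U \<subseteq> verts G" unfolding U_def using Ai(1) by (rule UN_least)
  have fl: "total_variation G (indicator {v \<in> U. c v = i})
      \<le> cheeger_const G k * mass G (indicator {v \<in> U. c v = i})" if "i \<in> c ` U" for i
  proof -
    have i: "i \<in> {1..k}" using that cU by blast
    show ?thesis
      unfolding fib[OF i] using small[OF i] expansion_le_iff[OF G Ai[OF i]] by blast
  qed
  show ?thesis
    using UV cU total_variation_block_le[OF G UV refl fl] by blast
qed

text \<open>
The coordinate subspace on which \<open>\<Phi>\<^sub>1\<close> is at least the Cheeger constant \<open>h\<close>. No \<open>k\<close> sets of
expansion less than \<open>h\<close> are pairwise disjoint, so the connected ones are hit by a set \<open>R\<close> of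
fewer than \<open>k\<close> vertices. Each of the others contains a connected one and is hit as well.
\<close>

lemma forest_hitting_set:
  assumes F: "weighted_forest n G" and k: "k \<in> {1..n}"
  shows "\<exists>R\<subseteq>verts G. card R < k \<and>
     (\<forall>x. (\<forall>v\<in>R. x v = 0) \<longrightarrow> cheeger_const G k * mass G x \<le> total_variation G x)"
proof -
  let ?h = "cheeger_const G k"
  have G: "weighted_graph n G" and acyclic: "\<nexists>vs. is_cycle G vs"
    using F by (auto simp: weighted_forest_def)
  have loopless: "{v} \<notin> edges G" for v
    using edge_verts(3)[OF G, of v v] by auto
  define \<F> where "\<F> = {A. A \<subseteq> verts G \<and> induces_connected G A \<and> expansion G A < ?h}"
  obtain R D where RD: "R \<subseteq> verts G" "D \<subseteq> \<F>" "pairwise disjnt D" "finite D"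
      "card R \<le> card D" "\<forall>A\<in>\<F>. A \<inter> R \<noteq> {}"
    using forest_packing_hitting[OF acyclic loopless finite_verts[OF G], of \<F>]
    by (auto simp: \<F>_def)
  have "card D < k"
  proof (rule ccontr)
    assume "\<not> card D < k"
    then obtain D' where D': "D' \<subseteq> D" "card D' = k" using obtain_subset_with_card_n not_le by metis
    then have "finite D'" using RD(4) finite_subset by blast
    then obtain g where g: "bij_betw g {1..k} D'"
      using ex_bij_betw_nat_finite_1 D'(2) by metis
    have gD: "g i \<in> D" if "i \<in> {1..k}" for i using g that D' by (auto simp: bij_betw_def)
    have "restrict g {1..k} \<in> disjoint_tuples G k"
    proof -
      have "g i \<inter> g j = {}" if "i \<in> {1..k}" "j \<in> {1..k}" "i \<noteq> j" for i j
      proof -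
        have "g i \<noteq> g j" using g that by (meson bij_betw_def inj_on_eq_iff)
        then show ?thesis
          using pairwiseD[OF RD(3) gD[OF that(1)] gD[OF that(2)]] by (simp add: disjnt_def)
      qed
      moreover have "g i \<in> Pow (verts G) \<and> g i \<noteq> {}" if "i \<in> {1..k}" for i
        using gD[OF that] RD(2) by (auto simp: \<F>_def induces_connected_def)
      ultimately show ?thesis
        unfolding disjoint_tuples_def disjoint_family_on_def by auto
    qed
    then obtain i where i: "i \<in> {1..k}" "?h \<le> expansion G (restrict g {1..k} i)"
      using cheeger_const_attained(2)[OF G k] by blast
    then show False using gD[OF i(1)] RD(2) by (auto simp: \<F>_def)
  qed
  then have "card R < k" using RD(5) by simp
  moreover have "?h * mass G x \<le> total_variation G x" if x: "\<forall>v\<in>R. x v = 0" for x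
  proof (rule total_variation_ge[OF G, where W = "- R"])
    fix A assume A: "A \<subseteq> - R" "A \<subseteq> verts G" "A \<noteq> {}"
    have "?h \<le> expansion G A"
    proof (rule ccontr)
      assume "\<not> ?h \<le> expansion G A"
      then obtain B where "B \<subseteq> A" "induces_connected G B" "expansion G B < ?h"
        using connected_subset_small_expansion[OF G A(2,3), of ?h] by auto
      then have "B \<in> \<F>" using A(2) by (simp add: \<F>_def)
      then show False using RD(6) A(1) \<open>B \<subseteq> A\<close> by blast
    qed
    then show "?h * mass G (indicator A) \<le> total_variation G (indicator A)"
      using le_expansion_iff[OF G A(2,3)] by simp
  qed (use x in auto)
  ultimately show ?thesis using RD(1) by blast
qed

section \<open>Equality of the three quantities\<close>

theorem theorem5:
  fixes G :: wgraph and n k :: nat and ind :: "nat \<Rightarrow> (nat \<Rightarrow> real) set \<Rightarrow> nat"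
  assumes "weighted_forest n G"
    and "admissible_index ind"
    and "k \<in> {1..n}"
  shows "cheeger_const G k = lambda_ind ind G k \<and>
         lambda_ind ind G k = lower_lambda_ind ind G k"
proof -
  define h where "h = cheeger_const G k"
  note ind = assms(2) and k = assms(3)
  have G: "weighted_graph n G" using assms(1) by (simp add: weighted_forest_def)
  have V: "verts G = {..<n}" using G by (simp add: weighted_graph_def)
  obtain C where C: "\<And>x. 0 \<le> Phi1 G x" "\<And>x. Phi1 G x \<le> C" using Phi1_bounded[OF G] by blast
  have bdd: "bdd_above (Phi1 G ` S)" "bdd_below (Phi1 G ` S)" for S
    using C by (auto intro!: bdd_aboveI2[of _ _ C] bdd_belowI2[of _ 0])
  have Phi1_le: "Phi1 G x \<le> h" if "S \<in> sym_compacts n" "x \<in> S" "total_variation G x \<le> h * mass G x" for S x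
    using that(3) mass_pos_sym_compacts[OF G that(1,2)] by (simp add: Phi1_eq pos_divide_le_eq)
  have le_Phi1: "h \<le> Phi1 G x" if "S \<in> sym_compacts n" "x \<in> S" "h * mass G x \<le> total_variation G x" for S x
    using that(3) mass_pos_sym_compacts[OF G that(1,2)] by (simp add: Phi1_eq pos_le_divide_eq)
  have cont: "continuous_on S (\<lambda>x. x v)" for S :: "(nat \<Rightarrow> real) set" and v
    by (rule continuous_on_subset[OF continuous_on_product_coordinates]) auto

  obtain U c where Uc: "U \<subseteq> verts G" "c ` U = {1..k}"
    and blocks: "\<And>t. total_variation G (\<lambda>v. if v \<in> U then t (c v) else 0)
        \<le> h * mass G (\<lambda>v. if v \<in> U then t (c v) else 0)"
    using optimal_blocks[OF G k] unfolding h_def by blast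
  have "U \<noteq> {}" using Uc(2) k by auto
  obtain R where R: "R \<subseteq> verts G" "card R < k"
    and off_R: "\<And>x. \<forall>v\<in>R. x v = 0 \<Longrightarrow> h * mass G x \<le> total_variation G x"
    using forest_hitting_set[OF assms(1) k] unfolding h_def by blast
  have finR: "finite R" using R(1) finite_verts[OF G] finite_subset by blast

  \<comment> \<open>The unit sphere of the block functions is a competitor for the min-max value.\<close>
  obtain S1 where S1: "S1 \<in> sym_compacts n" "k \<le> ind n S1"
    and S1_le: "\<And>x. x \<in> S1 \<Longrightarrow> Phi1 G x \<le> h"
  proof -
    obtain S where S: "S \<in> sym_compacts n" "k \<le> ind n S"
      and form: "\<forall>x\<in>S. \<exists>t. x = (\<lambda>v. if v \<in> U then t (c v) else 0)"
      using sphere_of_block_functions[OF ind, of U n c] Uc V \<open>U \<noteq> {}\<close> by auto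
    have "Phi1 G x \<le> h" if x: "x \<in> S" for x
    proof (rule Phi1_le[OF S(1) x])
      obtain t where "x = (\<lambda>v. if v \<in> U then t (c v) else 0)" using form x by blast
      then show "total_variation G x \<le> h * mass G x" using blocks by simp
    qed
    then show ?thesis using that[of S] S by blast
  qed

  \<comment> \<open>The unit sphere of the functions vanishing on \<open>R\<close> is a competitor for the max-min value.\<close>
  obtain S2 where S2: "S2 \<in> sym_compacts n" "n - k + 1 \<le> ind n S2"
    and S2_ge: "\<And>x. x \<in> S2 \<Longrightarrow> h \<le> Phi1 G x"
  proof -
    have card: "n - k + 1 \<le> card ({..<n} - R)"
      using R k by (simp add: card_Diff_subset[OF finR] V)
    then have "{..<n} - R \<noteq> {}" by (metis card.empty add_is_0 le_zero_eq one_neq_zero)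
    then obtain S where S: "S \<in> sym_compacts n" "card ({..<n} - R) \<le> ind n S"
      and "\<forall>x\<in>S. \<exists>t. x = (\<lambda>v. if v \<in> {..<n} - R then t v else 0)"
      using sphere_of_block_functions[OF ind, of "{..<n} - R" n "\<lambda>v. v"] by auto
    then have "h * mass G x \<le> total_variation G x" if "x \<in> S" for x
      using that by (intro off_R) fastforce
    then show ?thesis using that[of S] S card le_Phi1[OF S(1)] by force
  qed

  have upper: "\<exists>x\<in>S. h \<le> Phi1 G x" if S: "S \<in> sym_compacts n" "k \<le> ind n S" for S
  proof -
    have "\<exists>x\<in>S. \<forall>v\<in>R. x v = 0"
      using odd_functionals_common_zero[OF ind S(1) finR, of "\<lambda>v x. x v"] R(2) S(2) cont by simp
    then show ?thesis using off_R le_Phi1[OF S(1)] by blast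
  qed

  have lower: "\<exists>x\<in>S. Phi1 G x \<le> h" if S: "S \<in> sym_compacts n" "n - k + 1 \<le> ind n S" for S
  proof -
    have "\<forall>i\<in>{1..k}. \<exists>u. u \<in> U \<and> c u = i" unfolding Uc(2)[symmetric] by blast
    then obtain r where "\<forall>i\<in>{1..k}. r i \<in> U \<and> c (r i) = i"
      unfolding bchoice_iff by (elim exE)
    then have r: "r i \<in> U" "c (r i) = i" if "i \<in> {1..k}" for i using that by auto
    have inj: "inj_on r {1..k}" using r(2) by (rule inj_on_inverseI)
    \<comment> \<open>The block functions are cut out by \<open>n - k\<close> linear functionals, one for each vertex that
      is not the chosen representative \<open>r i\<close> of a block: inside a block the functional
      compares the vertex with the representative, outside it is the coordinate itself.\<close>
    define L where "L v x = x v - (if v \<in> U then x (r (c v)) else 0)" for v and x :: "nat \<Rightarrow> real"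
    have rV: "r ` {1..k} \<subseteq> {..<n}" using r(1) Uc(1) V by blast
    have card_L: "card ({..<n} - r ` {1..k}) = n - k"
      using rV card_image[OF inj] by (simp add: card_Diff_subset)
    have "\<exists>x\<in>S. \<forall>v\<in>{..<n} - r ` {1..k}. L v x = 0"
    proof (rule odd_functionals_common_zero[OF ind S(1)])
      show "continuous_on S (L v)" for v
        unfolding L_def by (cases "v \<in> U") (simp_all add: continuous_on_diff cont)
    qed (use card_L S(2) in \<open>simp_all add: L_def\<close>)
    then obtain x where x: "x \<in> S" "\<And>v. v \<in> {..<n} - r ` {1..k} \<Longrightarrow> L v x = 0"
      by blast
    have "x v = (if v \<in> U then x (r (c v)) else 0)" for v
    proof (cases "v \<in> {..<n} - r ` {1..k}")
      case True
      then show ?thesis using x(2)[OF True] by (simp add: L_def)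
    next
      case False
      then consider "n \<le> v" | i where "i \<in> {1..k}" "v = r i" by (auto simp: not_less)
      then show ?thesis
      proof cases
        case 1
        then have "x v = 0" using S(1) x(1) by (simp add: sym_compacts_iff)
        moreover have "v \<notin> U" using 1 Uc(1) V by auto
        ultimately show ?thesis by simp
      next
        case 2
        then show ?thesis using r[of i] by simp
      qed
    qed
    then have "x = (\<lambda>v. if v \<in> U then (\<lambda>i. x (r i)) (c v) else 0)" by auto
    then have "total_variation G x \<le> h * mass G x" using blocks[of "\<lambda>i. x (r i)"] by simp
    then show ?thesis using Phi1_le[OF S(1) x(1)] x(1) by blast
  qed

  have "lambda_ind ind G k = h"
    unfolding lambda_ind_def Let_def V card_lessThan
  proof (rule antisym)
    let ?\<S> = "{S \<in> sym_compacts n. k \<le> ind n S}"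
    have ge: "h \<le> (SUP x\<in>S. Phi1 G x)" if "S \<in> ?\<S>" for S
      using upper[of S] that bdd(1)[of S] by (auto intro: cSUP_upper2)
    show "h \<le> (INF S\<in>?\<S>. SUP x\<in>S. Phi1 G x)"
      using S1 ge by (intro cINF_greatest) auto
    have "(INF S\<in>?\<S>. SUP x\<in>S. Phi1 G x) \<le> (SUP x\<in>S1. Phi1 G x)"
      using S1 ge by (intro cINF_lower bdd_belowI2[of _ h]) auto
    also have "\<dots> \<le> h"
      using S1 S1_le by (intro cSUP_least) (auto simp: sym_compacts_iff)
    finally show "(INF S\<in>?\<S>. SUP x\<in>S. Phi1 G x) \<le> h" .
  qed
  moreover have "lower_lambda_ind ind G k = h"
    unfolding lower_lambda_ind_def Let_def V card_lessThan
  proof (rule antisym)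
    let ?\<S> = "{S \<in> sym_compacts n. n - k + 1 \<le> ind n S}"
    have le: "(INF x\<in>S. Phi1 G x) \<le> h" if "S \<in> ?\<S>" for S
      using lower[of S] that bdd(2)[of S] by (auto intro: cINF_lower2)
    show "(SUP S\<in>?\<S>. INF x\<in>S. Phi1 G x) \<le> h"
      using S2 le by (intro cSUP_least) auto
    have "h \<le> (INF x\<in>S2. Phi1 G x)"
      using S2 S2_ge by (intro cINF_greatest) (auto simp: sym_compacts_iff)
    also have "\<dots> \<le> (SUP S\<in>?\<S>. INF x\<in>S. Phi1 G x)"
      using S2 le by (intro cSUP_upper bdd_aboveI2[of _ _ h]) auto
    finally show "h \<le> (SUP S\<in>?\<S>. INF x\<in>S. Phi1 G x)" .
  qed
  ultimately show ?thesis by (simp add: h_def)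
qed

end
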